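(* Let $\mathbb{A}=\mathcal{K}_2$ be Kleene's second model, with elementary sub-PCA $\mathbb{A}'=\mathcal{K}_2^{rec}$, let $\mathfrak{T},\mathfrak{M},\mathfrak{M}_w$ be the associated Turing, Medvedev and Muchnik doctrines, and let $1$ be a one-element set. The (posets of) Turing degrees, Medvedev degrees, and Muchnik degrees are isomorphic respectively to $\mathfrak{T}(1)$, $\mathfrak{M}(1)$, and $\mathfrak{M}_w(1)$.
   Context: Kleene's second model $\mathcal{K}_2$ has underlying set $\mathbb{N}^{\mathbb{N}}$. For $\alpha\in\mathbb{N}^{\mathbb{N}}$ let $\alpha[n]=(\alpha(0),\dots,\alpha(n-1))$, and fix a computable coding $\langle\cdot\rangle$ of finite strings by natural numbers. Define the partial function $F_\alpha$ by $F_\alpha(\beta)=k$ if there is $n$ with $\alpha(\langle\beta[n]\rangle)=k+1$ and $\alpha(\langle\beta[m]\rangle)=0$ for all $m<n$, and undefined otherwise. Then $\alpha\cdot\beta$ is the map $n\mapsto F_\alpha((n)*\beta)$, defined when this map is total, where $*$ denotes concatenation, i.e. $((n)*\beta)(0)=n$ and $((n)*\beta)(i+1)=\beta(i)$. $\mathcal{K}_2^{rec}$ is the elementary sub-PCA of computable elements of $\mathbb{N}^{\mathbb{N}}$ (these represent the computable functionals $\beta\mapsto\alpha\cdot\beta$). The Turing degrees are the degrees of functions $\mathbb{N}\to\mathbb{N}$ under Turing reducibility. For $P,Q\subseteq\mathbb{N}^{\mathbb{N}}$: $P$ is Medvedev reducible to $Q$ if there is a computable functional $\Phi$, defined on all of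 $Q$, with $\Phi(Q)\subseteq P$; $P$ is Muchnik reducible to $Q$ if for every $q\in Q$ there is a computable functional $\Phi$ with $\Phi(q)\in P$. The Medvedev and Muchnik degrees are the poset reflections of these preorders on $\wp(\mathbb{N}^{\mathbb{N}})$. For a set $X$ each of the following posets is the poset reflection of the indicated preorder (all formulas include that the applications are defined). $\mathfrak{T}(X)$: functions $X\to\mathbb{A}$, $\alpha\le\beta$ iff $(\exists\overline a\in\mathbb{A}')(\forall x\in X)(\overline a\cdot\beta(x)=\alpha(x))$. $\mathfrak{M}(X)$: functions $X\to\wp(\mathbb{A})$, $\varphi\le\psi$ iff $(\exists\overline a\in\mathbb{A}')(\forall x\in X)(\forall b\in\psi(x))(\overline a\cdot b\in\varphi(x))$. $\mathfrak{M}_w(X)$: functions $X\to\wp(\mathbb{A})$, $\varphi\le\psi$ iff $(\forall x\in X)(\forall b\in\psi(x))(\exists\overline a\in\mathbb{A}')(\overline a\cdot b\in\varphi(x))$. *)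

theory Defs
  imports Main
begin

section \<open>Recursive functions with an oracle\<close>

text \<open>
  Partial recursive functions of several arguments, built from the usual initial functions and an
  oracle in \<open>\<nat> \<rightarrow> \<nat>\<close>. The arguments are passed as a list; arities are not enforced, and a
  program has no value where no rule applies. In \<open>PrimRec\<close> and \<open>Minim\<close> the recursion variable and the search
  variable, respectively, are the head of the argument list.
\<close>

datatype prog =
    Zero
  | Succ
  | Proj nat
  | Oracle
  | Comp prog "prog list"
  | PrimRec prog prog
  | Minim prog

inductive eval :: "(nat \<Rightarrow> nat) \<Rightarrow> prog \<Rightarrow> nat list \<Rightarrow> nat \<Rightarrow> bool" for \<beta> :: "nat \<Rightarrow> nat" where
  Zero: "eval \<beta> Zero xs 0"
| Succ: "eval \<beta> Succ [x] (Suc x)"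
| Proj: "i < length xs \<Longrightarrow> eval \<beta> (Proj i) xs (xs ! i)"
| Oracle: "eval \<beta> Oracle [x] (\<beta> x)"
| Comp: "list_all2 (\<lambda>g y. eval \<beta> g xs y) gs ys \<Longrightarrow> eval \<beta> f ys z \<Longrightarrow> eval \<beta> (Comp f gs) xs z"
| PrimRec_0: "eval \<beta> f xs z \<Longrightarrow> eval \<beta> (PrimRec f g) (0 # xs) z"
| PrimRec_Suc: "eval \<beta> (PrimRec f g) (n # xs) y \<Longrightarrow> eval \<beta> g (n # y # xs) z
    \<Longrightarrow> eval \<beta> (PrimRec f g) (Suc n # xs) z"
| Minim: "eval \<beta> f (n # xs) 0 \<Longrightarrow> (\<forall>m<n. \<exists>v. eval \<beta> f (m # xs) (Suc v))
    \<Longrightarrow> eval \<beta> (Minim f) xs n"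

fun oracle_free :: "prog \<Rightarrow> bool" where
  "oracle_free Oracle \<longleftrightarrow> False"
| "oracle_free (Comp f gs) \<longleftrightarrow> oracle_free f \<and> (\<forall>g\<in>set gs. oracle_free g)"
| "oracle_free (PrimRec f g) \<longleftrightarrow> oracle_free f \<and> oracle_free g"
| "oracle_free (Minim f) \<longleftrightarrow> oracle_free f"
| "oracle_free _ \<longleftrightarrow> True"

definition computable :: "(nat \<Rightarrow> nat) \<Rightarrow> bool" where
  "computable f \<longleftrightarrow> (\<exists>p. oracle_free p \<and> (\<forall>\<beta> x. eval \<beta> p [x] (f x)))"

definition computable2 :: "(nat \<Rightarrow> nat \<Rightarrow> nat) \<Rightarrow> bool" where
  "computable2 f \<longleftrightarrow> (\<exists>p. oracle_free p \<and> (\<forall>\<beta> x y. eval \<beta> p [x, y] (f x y)))"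

text \<open>
  A computable functional is a partial map on \<open>\<nat> \<rightarrow> \<nat>\<close> given by one oracle program, uniformly in the
  argument; its domain consists of those \<open>\<beta>\<close> for which the program with oracle \<open>\<beta>\<close> is total.
\<close>

definition computable_functional :: "((nat \<Rightarrow> nat) \<Rightarrow> (nat \<Rightarrow> nat) option) \<Rightarrow> bool" where
  "computable_functional \<Phi> \<longleftrightarrow>
     (\<exists>p. \<forall>\<beta> \<gamma>. \<Phi> \<beta> = Some \<gamma> \<longleftrightarrow> (\<forall>n. eval \<beta> p [n] (\<gamma> n)))"

section \<open>Posets and poset reflections\<close>

text \<open>
  A poset is represented as its carrier together with its order relation.
\<close>

definition poset_reflection :: "('a \<Rightarrow> 'a \<Rightarrow> bool) \<Rightarrow> 'a set set \<times> ('a set) rel" where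
  "poset_reflection le =
     (let D = UNIV // {(x, y). le x y \<and> le y x}
      in (D, {(C, C'). C \<in> D \<and> C' \<in> D \<and> (\<exists>x\<in>C. \<exists>y\<in>C'. le x y)}))"

definition poset_isomorphic :: "'a set \<times> 'a rel \<Rightarrow> 'b set \<times> 'b rel \<Rightarrow> bool" where
  "poset_isomorphic P Q \<longleftrightarrow>
     partial_order_on (fst P) (snd P) \<and> partial_order_on (fst Q) (snd Q) \<and>
     (\<exists>f. bij_betw f (fst P) (fst Q) \<and>
          (\<forall>x\<in>fst P. \<forall>y\<in>fst P. (x, y) \<in> snd P \<longleftrightarrow> (f x, f y) \<in> snd Q))"

section \<open>Turing, Medvedev and Muchnik degrees\<close>

definition turing_reducible :: "(nat \<Rightarrow> nat) \<Rightarrow> (nat \<Rightarrow> nat) \<Rightarrow> bool" where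
  "turing_reducible \<alpha> \<beta> \<longleftrightarrow> (\<exists>p. \<forall>n. eval \<beta> p [n] (\<alpha> n))"

definition medvedev_reducible :: "(nat \<Rightarrow> nat) set \<Rightarrow> (nat \<Rightarrow> nat) set \<Rightarrow> bool" where
  "medvedev_reducible P Q \<longleftrightarrow>
     (\<exists>\<Phi>. computable_functional \<Phi> \<and> (\<forall>q\<in>Q. \<exists>p\<in>P. \<Phi> q = Some p))"

definition muchnik_reducible :: "(nat \<Rightarrow> nat) set \<Rightarrow> (nat \<Rightarrow> nat) set \<Rightarrow> bool" where
  "muchnik_reducible P Q \<longleftrightarrow>
     (\<forall>q\<in>Q. \<exists>\<Phi>. computable_functional \<Phi> \<and> (\<exists>p\<in>P. \<Phi> q = Some p))"

definition turing_degrees :: "(nat \<Rightarrow> nat) set set \<times> (nat \<Rightarrow> nat) set rel" where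
  "turing_degrees = poset_reflection turing_reducible"

definition medvedev_degrees :: "(nat \<Rightarrow> nat) set set set \<times> (nat \<Rightarrow> nat) set set rel" where
  "medvedev_degrees = poset_reflection medvedev_reducible"

definition muchnik_degrees :: "(nat \<Rightarrow> nat) set set set \<times> (nat \<Rightarrow> nat) set set rel" where
  "muchnik_degrees = poset_reflection muchnik_reducible"

section \<open>The three doctrines\<close>

text \<open>
  The underlying set of the PCA is the type \<open>'a\<close>, its partial application is \<open>app\<close>, and \<open>A'\<close> is the
  elementary sub-PCA. The index set is the universe of the type \<open>'x\<close>.
\<close>

definition turing_le ::
    "('a \<Rightarrow> 'a \<Rightarrow> 'a option) \<Rightarrow> 'a set \<Rightarrow> ('x \<Rightarrow> 'a) \<Rightarrow> ('x \<Rightarrow> 'a) \<Rightarrow> bool" where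
  "turing_le app A' \<alpha> \<beta> \<longleftrightarrow> (\<exists>a\<in>A'. \<forall>x. app a (\<beta> x) = Some (\<alpha> x))"

definition medvedev_le ::
    "('a \<Rightarrow> 'a \<Rightarrow> 'a option) \<Rightarrow> 'a set \<Rightarrow> ('x \<Rightarrow> 'a set) \<Rightarrow> ('x \<Rightarrow> 'a set) \<Rightarrow> bool" where
  "medvedev_le app A' \<phi> \<psi> \<longleftrightarrow>
     (\<exists>a\<in>A'. \<forall>x. \<forall>b\<in>\<psi> x. \<exists>c\<in>\<phi> x. app a b = Some c)"

definition muchnik_le ::
    "('a \<Rightarrow> 'a \<Rightarrow> 'a option) \<Rightarrow> 'a set \<Rightarrow> ('x \<Rightarrow> 'a set) \<Rightarrow> ('x \<Rightarrow> 'a set) \<Rightarrow> bool" where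
  "muchnik_le app A' \<phi> \<psi> \<longleftrightarrow>
     (\<forall>x. \<forall>b\<in>\<psi> x. \<exists>a\<in>A'. \<exists>c\<in>\<phi> x. app a b = Some c)"

definition turing_doctrine ::
    "('a \<Rightarrow> 'a \<Rightarrow> 'a option) \<Rightarrow> 'a set \<Rightarrow> 'x itself \<Rightarrow> ('x \<Rightarrow> 'a) set set \<times> ('x \<Rightarrow> 'a) set rel" where
  "turing_doctrine app A' X = poset_reflection (turing_le app A')"

definition medvedev_doctrine ::
    "('a \<Rightarrow> 'a \<Rightarrow> 'a option) \<Rightarrow> 'a set \<Rightarrow> 'x itself
      \<Rightarrow> ('x \<Rightarrow> 'a set) set set \<times> ('x \<Rightarrow> 'a set) set rel" where
  "medvedev_doctrine app A' X = poset_reflection (medvedev_le app A')"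

definition muchnik_doctrine ::
    "('a \<Rightarrow> 'a \<Rightarrow> 'a option) \<Rightarrow> 'a set \<Rightarrow> 'x itself
      \<Rightarrow> ('x \<Rightarrow> 'a set) set set \<times> ('x \<Rightarrow> 'a set) set rel" where
  "muchnik_doctrine app A' X = poset_reflection (muchnik_le app A')"

section \<open>Kleene's second model\<close>

text \<open>
  A coding of finite strings is computable if, on codes, the length, the entries and appending one
  entry are computed by recursive functions. The first two conditions make the coding injective.
\<close>

definition computable_coding :: "(nat list \<Rightarrow> nat) \<Rightarrow> bool" where
  "computable_coding code \<longleftrightarrow>
     (\<exists>len. computable len \<and> (\<forall>s. len (code s) = length s)) \<and>
     (\<exists>entry. computable2 entry \<and> (\<forall>s. \<forall>i<length s. entry (code s) i = s ! i)) \<and>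
     (\<exists>snoc. computable2 snoc \<and> (\<forall>s x. snoc (code s) x = code (s @ [x])))"

definition prefix :: "(nat \<Rightarrow> nat) \<Rightarrow> nat \<Rightarrow> nat list" where
  "prefix \<alpha> n = map \<alpha> [0..<n]"

text \<open>
  \<open>K2_val code \<alpha> \<beta> k\<close> says that \<open>F\<^sub>\<alpha>(\<beta>)\<close> is defined with value \<open>k\<close>; such a \<open>k\<close> is unique.
\<close>

definition K2_val :: "(nat list \<Rightarrow> nat) \<Rightarrow> (nat \<Rightarrow> nat) \<Rightarrow> (nat \<Rightarrow> nat) \<Rightarrow> nat \<Rightarrow> bool" where
  "K2_val code \<alpha> \<beta> k \<longleftrightarrow>
     (\<exists>n. \<alpha> (code (prefix \<beta> n)) = k + 1 \<and> (\<forall>m<n. \<alpha> (code (prefix \<beta> m)) = 0))"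

text \<open>
  The sequence \<open>case_nat n \<beta>\<close> is \<open>(n) * \<beta>\<close>.
\<close>

definition K2_app ::
    "(nat list \<Rightarrow> nat) \<Rightarrow> (nat \<Rightarrow> nat) \<Rightarrow> (nat \<Rightarrow> nat) \<Rightarrow> (nat \<Rightarrow> nat) option" where
  "K2_app code \<alpha> \<beta> =
     (if \<forall>n. \<exists>k. K2_val code \<alpha> (case_nat n \<beta>) k
      then Some (\<lambda>n. THE k. K2_val code \<alpha> (case_nat n \<beta>) k)
      else None)"

definition K2_rec :: "(nat \<Rightarrow> nat) set" where
  "K2_rec = {\<alpha>. computable \<alpha>}"

end

theory Submission
  imports Defs
begin

text \<open>
  A computable \<open>\<alpha>\<close> yields the oracle program that searches for the first prefix of \<open>(n) * \<beta>\<close> on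
  which \<open>\<alpha>\<close> is nonzero. Conversely, a program \<open>p\<close> is evaluated with the oracle restricted to its
  first \<open>L\<close> values and with all unbounded searches cut off at \<open>L\<close>. For fixed \<open>p\<close> this bounded
  evaluation is a total computable function of the finite oracle, every value it returns is the
  value of \<open>p\<close>, and it finds each value of \<open>p\<close> for all large \<open>L\<close>; so it is an associate of \<open>p\<close>.
  Hence application to computable elements and oracle programs define the same
  reductions, uniformly in the argument, and the three preorders coincide.
\<close>

section \<open>Bounded evaluation\<close>

text \<open>
  The value \<open>0\<close> encodes that the search is still running, \<open>1\<close> that it met an undefined value, and
  \<open>n + 2\<close> that it stopped at \<open>n\<close>. The values of \<open>h\<close> are encoded as those of \<open>bounded_eval\<close> below.
\<close>

primrec search :: "(nat \<Rightarrow> nat) \<Rightarrow> nat \<Rightarrow> nat" where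
  "search h 0 = 0"
| "search h (Suc j) =
     (if search h j = 0
      then if h j = 0 then 1 else if h j - 1 = 0 then Suc (Suc j) else 0
      else search h j)"

lemma search_eq_0_iff: "search h j = 0 \<longleftrightarrow> (\<forall>m<j. h m > 1)"
  by (induction j) (auto simp: less_Suc_eq)

lemma search_eq_iff: "search h j = Suc (Suc n) \<longleftrightarrow> n < j \<and> h n = 1 \<and> (\<forall>m<n. h m > 1)"
proof (induction j)
  case 0
  then show ?case by simp
next
  case (Suc j)
  show ?case
  proof (cases "search h j = 0")
    case True
    then have *: "\<forall>m<j. h m > 1" by (simp add: search_eq_0_iff)
    then have "\<not> (n < j \<and> h n = 1)" by fastforce
    then show ?thesis using True * by (auto simp: less_Suc_eq)
  next
    case False
    then obtain m where "m < j" "\<not> h m > 1" by (auto simp: search_eq_0_iff)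
    then show ?thesis using False Suc.IH by (auto simp: less_Suc_eq)
  qed
qed

lemma search_cong: "(\<And>j. h j = h' j) \<Longrightarrow> search h n = search h' n"
  by (induction n) auto

text \<open>The value \<open>0\<close> encodes undefinedness and \<open>k + 1\<close> the value \<open>k\<close>.\<close>

fun bounded_eval :: "nat \<Rightarrow> (nat \<Rightarrow> nat) \<Rightarrow> prog \<Rightarrow> nat list \<Rightarrow> nat" where
  "bounded_eval L e Zero xs = 1"
| "bounded_eval L e Succ xs = (if length xs = 1 then Suc (Suc (hd xs)) else 0)"
| "bounded_eval L e (Proj i) xs = (if i < length xs then Suc (xs ! i) else 0)"
| "bounded_eval L e Oracle xs = (if length xs = 1 \<and> hd xs < L then Suc (e (hd xs)) else 0)"
| "bounded_eval L e (Comp f gs) xs =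
     (if \<exists>g\<in>set gs. bounded_eval L e g xs = 0 then 0
      else bounded_eval L e f (map (\<lambda>g. bounded_eval L e g xs - 1) gs))"
| "bounded_eval L e (PrimRec f g) xs =
     (if xs = [] then 0
      else rec_nat (bounded_eval L e f (tl xs))
        (\<lambda>m r. if r = 0 then 0 else bounded_eval L e g (m # (r - 1) # tl xs)) (hd xs))"
| "bounded_eval L e (Minim f) xs = search (\<lambda>n. bounded_eval L e f (n # xs)) L - 1"

text \<open>The oracle clause is the only access to \<open>e\<close>, and it is guarded by the bound
  \<open>L\<close>. An infinite oracle may therefore be exchanged for its first \<open>L\<close>
  values.\<close>

lemma bounded_eval_cong:
  assumes "\<And>x. x < L \<Longrightarrow> e x = e' x"
  shows "bounded_eval L e p xs = bounded_eval L e' p xs"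
proof (induction p arbitrary: xs)
  case (Comp f gs)
  then show ?case by (auto cong: map_cong)
next
  case (PrimRec f g)
  then show ?case by (simp cong: if_cong)
qed (use assms in \<open>auto cong: search_cong\<close>)

text \<open>The bounds can only make a value undefined, never change it, so by induction on the
  program every positive result unwinds into a derivation.\<close>

lemma bounded_eval_sound: "bounded_eval L \<beta> p xs = Suc y \<Longrightarrow> eval \<beta> p xs y"
proof (induction p arbitrary: xs y)
  case Zero
  then show ?case by (auto intro: eval.intros)
next
  case Succ
  then show ?case by (cases xs) (auto intro: eval.intros split: if_splits)
next
  case (Proj i)
  then show ?case by (auto intro: eval.intros split: if_splits)
next
  case Oracle
  then show ?case by (cases xs) (auto intro: eval.intros split: if_splits)
next
  case (Comp f gs)
  from Comp.prems have nz: "\<forall>g\<in>set gs. bounded_eval L \<beta> g xs \<noteq> 0"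
    and f: "bounded_eval L \<beta> f (map (\<lambda>g. bounded_eval L \<beta> g xs - 1) gs) = Suc y"
    by (auto split: if_splits)
  have "list_all2 (\<lambda>g y. eval \<beta> g xs y) gs (map (\<lambda>g. bounded_eval L \<beta> g xs - 1) gs)"
    using nz Comp.IH(2) by (auto simp: list_all2_conv_all_nth)
  with Comp.IH(1)[OF f] show ?case by (auto intro: eval.intros)
next
  case (PrimRec f g)
  from PrimRec.prems obtain n zs where xs: "xs = n # zs"
    by (cases xs) auto
  have "bounded_eval L \<beta> (PrimRec f g) (n # zs) = Suc y \<Longrightarrow> eval \<beta> (PrimRec f g) (n # zs) y"
  proof (induction n arbitrary: y)
    case 0
    then show ?case using PrimRec.IH(1) by (auto intro: eval.intros)
  next
    case (Suc n)
    define r where "r = bounded_eval L \<beta> (PrimRec f g) (n # zs)"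
    have "r \<noteq> 0" "bounded_eval L \<beta> g (n # (r - 1) # zs) = Suc y"
      using Suc.prems by (auto simp: r_def split: if_splits cong: if_cong)
    moreover from this(1) have "eval \<beta> (PrimRec f g) (n # zs) (r - 1)"
      using Suc.IH[of "r - 1"] by (simp add: r_def)
    ultimately show ?case
      using PrimRec.IH(2) by (auto intro: eval.intros)
  qed
  with PrimRec.prems xs show ?case by blast
next
  case (Minim f)
  let ?h = "\<lambda>n. bounded_eval L \<beta> f (n # xs)"
  \<comment> \<open>The predecessor after \<open>search\<close> merges its codes for a running and
    for a failed search into 0, so a defined value comes from a search that has stopped.\<close>
  from Minim.prems have "search ?h L = Suc (Suc y)" by simp
  then have *: "?h y = Suc 0" "\<forall>m<y. ?h m > 1" by (auto simp: search_eq_iff)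
  have "\<exists>v. eval \<beta> f (m # xs) (Suc v)" if "m < y" for m
  proof -
    from *(2) that obtain v where "?h m = Suc (Suc v)"
      by (metis One_nat_def less_imp_Suc_add add_Suc)
    then show ?thesis using Minim.IH by blast
  qed
  with *(1) Minim.IH show ?case by (auto intro: eval.intros)
qed

text \<open>Each rule has finitely many premises, so the thresholds beyond which their values are
  found combine into one; asking for all large \<open>L\<close> makes the premises available at a
  common bound. \<open>Oracle\<close> and \<open>Minim\<close> also need \<open>L\<close> to exceed
  the query and the search result.\<close>

lemma bounded_eval_complete:
  "eval \<beta> p xs y \<Longrightarrow> \<forall>\<^sub>F L in sequentially. bounded_eval L \<beta> p xs = Suc y"
proof (induction rule: eval.induct)
  case (Oracle x)
  show ?case using eventually_gt_at_top[of x] by eventually_elim simp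
next
  case (Comp xs gs ys f z)
  from Comp.IH(1) have "\<forall>\<^sub>F L in sequentially. map (\<lambda>g. bounded_eval L \<beta> g xs) gs = map Suc ys"
  proof (induction rule: list_all2_induct)
    case (Cons g gs y ys)
    from Cons(1)[THEN conjunct2] Cons(3) show ?case by eventually_elim simp
  qed simp
  with Comp.IH(2) show ?case
  proof eventually_elim
    case (elim L)
    have "0 \<notin> set (map (\<lambda>g. bounded_eval L \<beta> g xs) gs)" unfolding elim(2) by simp
    moreover have "map (\<lambda>g. bounded_eval L \<beta> g xs - 1) gs
        = map (\<lambda>v. v - 1) (map (\<lambda>g. bounded_eval L \<beta> g xs) gs)" by simp
    then have "map (\<lambda>g. bounded_eval L \<beta> g xs - 1) gs = ys" unfolding elim(2) by (simp add: o_def)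
    ultimately show ?case using elim(1) by force
  qed
next
  case (PrimRec_0 f xs z g)
  from PrimRec_0.IH show ?case by eventually_elim simp
next
  case (PrimRec_Suc f g n xs y z)
  from PrimRec_Suc.IH show ?case by eventually_elim (simp cong: if_cong)
next
  case (Minim f n xs)
  have "\<forall>m\<in>{..<n}. \<forall>\<^sub>F L in sequentially. bounded_eval L \<beta> f (m # xs) > 1"
  proof
    fix m assume "m \<in> {..<n}"
    with Minim.IH(2) obtain v where
      "\<forall>\<^sub>F L in sequentially. bounded_eval L \<beta> f (m # xs) = Suc (Suc v)" by blast
    then show "\<forall>\<^sub>F L in sequentially. bounded_eval L \<beta> f (m # xs) > 1" by eventually_elim simp
  qed
  then have "\<forall>\<^sub>F L in sequentially. \<forall>m\<in>{..<n}. bounded_eval L \<beta> f (m # xs) > 1"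
    by (intro eventually_ball_finite) auto
  with Minim.IH(1) eventually_gt_at_top[of n] show ?case
  proof eventually_elim
    case (elim L)
    then have "search (\<lambda>n. bounded_eval L \<beta> f (n # xs)) L = Suc (Suc n)"
      by (simp add: search_eq_iff)
    then show ?case by simp
  qed
qed simp_all

text \<open>Both values are returned by the bounded evaluation, which is a function, at a common
  large \<open>L\<close>.\<close>

lemma eval_functional:
  assumes "eval \<beta> p xs y" "eval \<beta> p xs z"
  shows "y = z"
proof -
  have "\<forall>\<^sub>F L in sequentially. y = z"
    using bounded_eval_complete[OF assms(1)] bounded_eval_complete[OF assms(2)]
    by eventually_elim simp
  then show ?thesis by simp
qed

section \<open>Total functions given by programs\<close>

text \<open>The flag \<open>b\<close> forbids the oracle.\<close>

definition rec_fun :: "bool \<Rightarrow> nat \<Rightarrow> ((nat \<Rightarrow> nat) \<Rightarrow> nat list \<Rightarrow> nat) \<Rightarrow> bool" where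
  "rec_fun b k F \<longleftrightarrow>
     (\<exists>p. (b \<longrightarrow> oracle_free p) \<and> (\<forall>\<beta> xs. length xs = k \<longrightarrow> eval \<beta> p xs (F \<beta> xs)))"

lemma rec_fun_cong:
  assumes "rec_fun b k F" "\<And>\<beta> xs. length xs = k \<Longrightarrow> F \<beta> xs = G \<beta> xs"
  shows "rec_fun b k G"
  using assms unfolding rec_fun_def by metis

lemma rec_fun_proj: "i < k \<Longrightarrow> rec_fun b k (\<lambda>\<beta> xs. xs ! i)"
  unfolding rec_fun_def by (rule exI[of _ "Proj i"]) (auto intro: eval.intros)

lemma rec_fun_comp:
  assumes F: "rec_fun b (length Gs) F" and Gs: "\<forall>G\<in>set Gs. rec_fun b k G"
  shows "rec_fun b k (\<lambda>\<beta> xs. F \<beta> (map (\<lambda>G. G \<beta> xs) Gs))"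
proof -
  from F obtain p where p: "b \<longrightarrow> oracle_free p"
    "\<And>\<beta> xs. length xs = length Gs \<Longrightarrow> eval \<beta> p xs (F \<beta> xs)"
    by (auto simp: rec_fun_def)
  from Gs obtain q where q: "\<And>G. G \<in> set Gs \<Longrightarrow> b \<longrightarrow> oracle_free (q G)"
    "\<And>G \<beta> xs. G \<in> set Gs \<Longrightarrow> length xs = k \<Longrightarrow> eval \<beta> (q G) xs (G \<beta> xs)"
    unfolding rec_fun_def by metis
  have "eval \<beta> (Comp p (map q Gs)) xs (F \<beta> (map (\<lambda>G. G \<beta> xs) Gs))" if "length xs = k" for \<beta> xs
    using that p(2) q(2) by (intro eval.Comp[where ys = "map (\<lambda>G. G \<beta> xs) Gs"]) (auto simp: list_all2_conv_all_nth)
  with p(1) q(1) show ?thesis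
    unfolding rec_fun_def by (intro exI[of _ "Comp p (map q Gs)"]) auto
qed

lemma rec_fun_comp1:
  assumes "rec_fun b 1 (\<lambda>\<beta> xs. F \<beta> (xs ! 0))" "rec_fun b k G"
  shows "rec_fun b k (\<lambda>\<beta> xs. F \<beta> (G \<beta> xs))"
  using rec_fun_comp[of b "[G]" "\<lambda>\<beta> xs. F \<beta> (xs ! 0)" k] assms by simp

lemma rec_fun_computable:
  assumes "computable f" "rec_fun b k G"
  shows "rec_fun b k (\<lambda>\<beta> xs. f (G \<beta> xs))"
proof (rule rec_fun_comp1[where F = "\<lambda>_. f"])
  show "rec_fun b 1 (\<lambda>\<beta> xs. f (xs ! 0))"
    using assms(1) unfolding rec_fun_def computable_def
    by (metis length_Suc_conv length_0_conv nth_Cons_0 One_nat_def)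
qed (fact assms)

lemma rec_fun_computable2:
  assumes "computable2 f" "rec_fun b k G" "rec_fun b k H"
  shows "rec_fun b k (\<lambda>\<beta> xs. f (G \<beta> xs) (H \<beta> xs))"
proof -
  from assms(1) obtain p where "oracle_free p" "\<And>\<beta> x y. eval \<beta> p [x, y] (f x y)"
    by (auto simp: computable2_def)
  then have "rec_fun b 2 (\<lambda>\<beta> xs. f (xs ! 0) (xs ! 1))"
    unfolding rec_fun_def
    by (intro exI[of _ p]) (auto simp: length_Suc_conv numeral_2_eq_2)
  then show ?thesis
    using rec_fun_comp[of b "[G, H]" "\<lambda>\<beta> xs. f (xs ! 0) (xs ! 1)" k] assms(2,3)
    by (simp add: numeral_2_eq_2)
qed

lemma rec_fun_oracle:
  assumes "rec_fun False k G"
  shows "rec_fun False k (\<lambda>\<beta> xs. \<beta> (G \<beta> xs))"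
proof (rule rec_fun_comp1[where F = "\<lambda>\<beta>. \<beta>"])
  show "rec_fun False 1 (\<lambda>\<beta> xs. \<beta> (xs ! 0))"
    unfolding rec_fun_def
    by (intro exI[of _ Oracle]) (auto simp: length_Suc_conv intro: eval.intros)
qed (fact assms)

lemma rec_fun_Suc:
  assumes "rec_fun b k G"
  shows "rec_fun b k (\<lambda>\<beta> xs. Suc (G \<beta> xs))"
proof (rule rec_fun_comp1[where F = "\<lambda>_. Suc"])
  show "rec_fun b 1 (\<lambda>\<beta> xs. Suc (xs ! 0))"
    unfolding rec_fun_def
    by (intro exI[of _ Succ]) (auto simp: length_Suc_conv intro: eval.intros)
qed (fact assms)

lemma rec_fun_const: "rec_fun b k (\<lambda>\<beta> xs. c)"
proof (induction c)
  case 0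
  show ?case unfolding rec_fun_def by (intro exI[of _ Zero]) (auto intro: eval.intros)
qed (rule rec_fun_Suc)

lemma rec_fun_primrec:
  assumes F: "rec_fun b k F" and G: "rec_fun b (Suc (Suc k)) (\<lambda>\<beta> ys. G \<beta> (ys ! 0) (ys ! 1) (drop 2 ys))"
    and N: "rec_fun b k N"
  shows "rec_fun b k (\<lambda>\<beta> xs. rec_nat (F \<beta> xs) (\<lambda>m r. G \<beta> m r xs) (N \<beta> xs))"
proof -
  from F obtain p where p: "b \<longrightarrow> oracle_free p"
    "\<And>\<beta> xs. length xs = k \<Longrightarrow> eval \<beta> p xs (F \<beta> xs)"
    by (auto simp: rec_fun_def)
  from G obtain q where q: "b \<longrightarrow> oracle_free q"
    "\<And>\<beta> ys. length ys = Suc (Suc k) \<Longrightarrow> eval \<beta> q ys (G \<beta> (ys ! 0) (ys ! 1) (drop 2 ys))"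
    by (auto simp: rec_fun_def)
  let ?R = "\<lambda>\<beta> n xs. rec_nat (F \<beta> xs) (\<lambda>m r. G \<beta> m r xs) n"
  have "eval \<beta> (PrimRec p q) (n # xs) (?R \<beta> n xs)" if "length xs = k" for \<beta> n xs
  proof (induction n)
    case 0
    show ?case using p(2)[OF that] by (auto intro: eval.intros)
  next
    case (Suc n)
    have "eval \<beta> q (n # ?R \<beta> n xs # xs) (?R \<beta> (Suc n) xs)"
      using q(2)[of "n # ?R \<beta> n xs # xs" \<beta>] that by simp
    with Suc show ?case by (rule eval.PrimRec_Suc)
  qed
  then have "rec_fun b (Suc k) (\<lambda>\<beta> ys. ?R \<beta> (ys ! 0) (drop 1 ys))"
    unfolding rec_fun_def
    by (intro exI[of _ "PrimRec p q"]) (use p(1) q(1) in \<open>auto simp: length_Suc_conv\<close>)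
  \<comment> \<open>\<open>PrimRec\<close> recurses on the head of its argument list; composing with
    \<open>N\<close> and all \<open>k\<close> projections supplies
    \<open>N \<beta> xs # xs\<close>.\<close>
  then have "rec_fun b k (\<lambda>\<beta> xs. ?R \<beta> (map (\<lambda>G. G \<beta> xs) (N # map (\<lambda>i \<beta> xs. xs ! i) [0..<k]) ! 0)
      (drop 1 (map (\<lambda>G. G \<beta> xs) (N # map (\<lambda>i \<beta> xs. xs ! i) [0..<k]))))"
    by (intro rec_fun_comp) (auto intro: N rec_fun_proj)
  then show ?thesis
  proof (rule rec_fun_cong)
    fix \<beta> and xs :: "nat list" assume "length xs = k"
    then have "map (\<lambda>i. xs ! i) [0..<k] = xs" using map_nth by blast
    then show "?R \<beta> (map (\<lambda>G. G \<beta> xs) (N # map (\<lambda>i \<beta> xs. xs ! i) [0..<k]) ! 0)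
      (drop 1 (map (\<lambda>G. G \<beta> xs) (N # map (\<lambda>i \<beta> xs. xs ! i) [0..<k]))) = ?R \<beta> (N \<beta> xs) xs"
      by (simp add: o_def)
  qed
qed

lemma rec_fun_drop:
  assumes "rec_fun b k F" "n = j + k"
  shows "rec_fun b n (\<lambda>\<beta> ys. F \<beta> (drop j ys))"
proof -
  let ?Gs = "map (\<lambda>i \<beta> ys. ys ! i) [j..<n]"
  have "rec_fun b n (\<lambda>\<beta> ys. F \<beta> (map (\<lambda>G. G \<beta> ys) ?Gs))"
    using assms by (intro rec_fun_comp) (auto intro: rec_fun_proj)
  then show ?thesis
  proof (rule rec_fun_cong)
    fix \<beta> and ys :: "nat list" assume "length ys = n"
    then have "map (\<lambda>i. ys ! i) [j..<n] = drop j ys" by (auto intro: nth_equalityI)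
    then show "F \<beta> (map (\<lambda>G. G \<beta> ys) ?Gs) = F \<beta> (drop j ys)" by (simp add: o_def)
  qed
qed

text \<open>Recursion along \<open>N\<close> whose step ignores the counter and the previous value:
  with no round the result is \<open>F\<close>, with any positive number of rounds it is
  \<open>G\<close>.\<close>

lemma rec_fun_if:
  assumes "rec_fun b k N" "rec_fun b k F" "rec_fun b k G"
  shows "rec_fun b k (\<lambda>\<beta> xs. if N \<beta> xs = 0 then F \<beta> xs else G \<beta> xs)"
proof -
  have "rec_fun b k (\<lambda>\<beta> xs. rec_nat (F \<beta> xs) (\<lambda>_ _. G \<beta> xs) (N \<beta> xs))"
    using assms(1,2) rec_fun_drop[OF assms(3), of "Suc (Suc k)" 2]
    by (intro rec_fun_primrec) auto
  then show ?thesis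
    by (rule rec_fun_cong) (auto simp: gr0_conv_Suc)
qed

lemma rec_fun_pred:
  assumes "rec_fun b k N"
  shows "rec_fun b k (\<lambda>\<beta> xs. N \<beta> xs - 1)"
proof -
  \<comment> \<open>The step returns its counter, which in the last round is one less than
    \<open>N \<beta> xs\<close>; without a round the result is 0, in accordance with truncated
    subtraction.\<close>
  have "rec_fun b k (\<lambda>\<beta> xs. rec_nat 0 (\<lambda>m _. m) (N \<beta> xs))"
    using assms by (intro rec_fun_primrec) (auto intro: rec_fun_const rec_fun_proj)
  then show ?thesis
  proof (rule rec_fun_cong)
    show "rec_nat 0 (\<lambda>m _. m) (N \<beta> xs) = N \<beta> xs - 1" for \<beta> xs by (cases "N \<beta> xs") auto
  qed
qed

lemma rec_fun_diff:
  assumes "rec_fun b k M" "rec_fun b k N"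
  shows "rec_fun b k (\<lambda>\<beta> xs. M \<beta> xs - N \<beta> xs)"
proof -
  have "rec_fun b k (\<lambda>\<beta> xs. rec_nat (M \<beta> xs) (\<lambda>_ r. r - 1) (N \<beta> xs))"
    using assms by (intro rec_fun_primrec rec_fun_pred rec_fun_proj) auto
  then show ?thesis
  proof (rule rec_fun_cong)
    have "rec_nat m (\<lambda>_ r. r - 1) n = m - n" for m n :: nat by (induction n) auto
    then show "rec_nat (M \<beta> xs) (\<lambda>_ r. r - 1) (N \<beta> xs) = M \<beta> xs - N \<beta> xs" for \<beta> xs by simp
  qed
qed

text \<open>The list is fixed, so the quantifier unfolds into nested case distinctions. This detects
  an undefined argument in the \<open>Comp\<close> clause of \<open>bounded_eval\<close>.\<close>

lemma rec_fun_ex_zero: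
  assumes "\<forall>G\<in>set Gs. rec_fun b k G"
  shows "rec_fun b k (\<lambda>\<beta> xs. if \<exists>G\<in>set Gs. G \<beta> xs = 0 then 0 else 1)"
  using assms
proof (induction Gs)
  case Nil
  then show ?case by (simp add: rec_fun_const)
next
  case (Cons G Gs)
  then have "rec_fun b k (\<lambda>\<beta> xs. if G \<beta> xs = 0 then 0
      else if \<exists>G\<in>set Gs. G \<beta> xs = 0 then 0 else 1)"
    by (intro rec_fun_if rec_fun_const) auto
  then show ?case by (rule rec_fun_cong) auto
qed

lemma rec_fun_drop_proj: "j + i < k \<Longrightarrow> rec_fun b k (\<lambda>\<beta> ys. drop j ys ! i)"
  by (rule rec_fun_cong[OF rec_fun_proj[of "j + i"]]) auto

text \<open>This is the shape of the recursive calls of \<open>bounded_eval\<close>: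
  \<open>C\<close> supplies the parameter that determines bound and oracle, and the new arguments
  \<open>Gs\<close> are put in front of what is kept of the old list.\<close>

lemma rec_fun_subst:
  assumes F: "rec_fun b (Suc k) (\<lambda>\<beta> ys. F \<beta> (ys ! 0) (drop 1 ys))"
    and C: "rec_fun b n C" and Gs: "\<forall>G\<in>set Gs. rec_fun b n G"
    and k: "k = length Gs + (n - j)"
  shows "rec_fun b n (\<lambda>\<beta> xs. F \<beta> (C \<beta> xs) (map (\<lambda>G. G \<beta> xs) Gs @ drop j xs))"
proof -
  let ?Hs = "C # Gs @ map (\<lambda>i \<beta> ys. ys ! i) [j..<n]"
  have "rec_fun b n (\<lambda>\<beta> xs. F \<beta> (map (\<lambda>G. G \<beta> xs) ?Hs ! 0) (drop 1 (map (\<lambda>G. G \<beta> xs) ?Hs)))"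
    using F C Gs k by (intro rec_fun_comp) (auto intro: rec_fun_proj)
  then show ?thesis
  proof (rule rec_fun_cong)
    fix \<beta> and xs :: "nat list" assume "length xs = n"
    then have "map (\<lambda>i. xs ! i) [j..<n] = drop j xs" by (auto intro: nth_equalityI)
    then show "F \<beta> (map (\<lambda>G. G \<beta> xs) ?Hs ! 0) (drop 1 (map (\<lambda>G. G \<beta> xs) ?Hs))
        = F \<beta> (C \<beta> xs) (map (\<lambda>G. G \<beta> xs) Gs @ drop j xs)"
      by (simp add: o_def)
  qed
qed

section \<open>Bounded evaluation is computable\<close>

lemma search_conv_rec_nat:
  "search h n = rec_nat 0 (\<lambda>j s. if s = 0
     then if h j = 0 then 1 else if h j - 1 = 0 then Suc (Suc j) else 0 else s) n"
  by (induction n) (simp_all cong: if_cong)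

text \<open>The head of the list is a parameter that determines bound and oracle. The program and
  the number \<open>k\<close> of its arguments are fixed, so neither has to be coded, and arity
  tests become case distinctions on \<open>k\<close>. In the induction \<open>k\<close> varies
  because subprograms receive other numbers of arguments.\<close>

lemma rec_fun_bounded_eval:
  assumes l: "computable l" and e: "computable2 e"
  shows "rec_fun b (Suc k) (\<lambda>\<beta> ys. bounded_eval (l (ys ! 0)) (e (ys ! 0)) p (drop 1 ys))"
proof (induction p arbitrary: k)
  case Zero
  show ?case by (simp add: rec_fun_const)
next
  case Succ
  show ?case
  proof (cases "k = 1")
    case True
    have "rec_fun b (Suc k) (\<lambda>\<beta> ys. Suc (Suc (ys ! 1)))"
      using True by (intro rec_fun_Suc rec_fun_proj) simp
    then show ?thesis
      by (rule rec_fun_cong) (use True in \<open>auto simp: hd_drop_conv_nth\<close>)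
  next
    case False
    then show ?thesis by (intro rec_fun_cong[OF rec_fun_const[of _ _ 0]]) simp
  qed
next
  case (Proj i)
  show ?case
  proof (cases "i < k")
    case True
    have "rec_fun b (Suc k) (\<lambda>\<beta> ys. Suc (ys ! Suc i))"
      using True by (intro rec_fun_Suc rec_fun_proj) simp
    then show ?thesis by (rule rec_fun_cong) (use True in auto)
  next
    case False
    then show ?thesis by (intro rec_fun_cong[OF rec_fun_const[of _ _ 0]]) simp
  qed
next
  case Oracle
  show ?case
  proof (cases "k = 1")
    case True
    \<comment> \<open>The truncated difference vanishes exactly when the query is not below the
      bound.\<close>
    have "rec_fun b (Suc k) (\<lambda>\<beta> ys. if l (ys ! 0) - ys ! 1 = 0 then 0 else Suc (e (ys ! 0) (ys ! 1)))"
      using True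
      by (intro rec_fun_if rec_fun_diff rec_fun_Suc rec_fun_const rec_fun_computable[OF l]
          rec_fun_computable2[OF e] rec_fun_proj) auto
    then show ?thesis
      by (rule rec_fun_cong) (use True in \<open>auto simp: hd_drop_conv_nth\<close>)
  next
    case False
    then show ?thesis by (intro rec_fun_cong[OF rec_fun_const[of _ _ 0]]) simp
  qed
next
  case (Comp f gs)
  let ?B = "\<lambda>p ys. bounded_eval (l (ys ! 0)) (e (ys ! 0)) p (drop 1 ys)"
  let ?Gs = "map (\<lambda>g (\<beta>::nat \<Rightarrow> nat) ys. ?B g ys) gs"
  let ?Hs = "map (\<lambda>g (\<beta>::nat \<Rightarrow> nat) ys. ?B g ys - 1) gs"
  have "rec_fun b (Suc k) (\<lambda>\<beta> ys. if \<exists>G\<in>set ?Gs. G \<beta> ys = 0 then 0 else 1)"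
    using Comp.IH(2) by (intro rec_fun_ex_zero) auto
  \<comment> \<open>Dropping all \<open>Suc k\<close> entries leaves just the values of
    \<open>gs\<close> as arguments of \<open>f\<close>.\<close>
  moreover have "rec_fun b (Suc k) (\<lambda>\<beta> ys. bounded_eval (l (ys ! 0)) (e (ys ! 0)) f
      (map (\<lambda>G. G \<beta> ys) ?Hs @ drop (Suc k) ys))"
    using Comp.IH
    by (intro rec_fun_subst[where F = "\<lambda>\<beta> c. bounded_eval (l c) (e c) f", OF Comp.IH(1)])
      (auto intro!: rec_fun_proj rec_fun_pred[unfolded One_nat_def])
  ultimately have "rec_fun b (Suc k) (\<lambda>\<beta> ys.
      if (if \<exists>G\<in>set ?Gs. G \<beta> ys = 0 then 0 else 1 :: nat) = 0 then 0
      else bounded_eval (l (ys ! 0)) (e (ys ! 0)) f (map (\<lambda>G. G \<beta> ys) ?Hs @ drop (Suc k) ys))"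
    by (intro rec_fun_if rec_fun_const)
  then show ?case by (rule rec_fun_cong) (auto simp: o_def)
next
  case (PrimRec f g)
  show ?case
  proof (cases k)
    case 0
    then show ?thesis by (intro rec_fun_cong[OF rec_fun_const[of _ _ 0]]) simp
  next
    case (Suc j)
    have f: "rec_fun b (Suc k)
        (\<lambda>\<beta> ys. bounded_eval (l (ys ! 0)) (e (ys ! 0)) f (map (\<lambda>G. G \<beta> ys) [] @ drop 2 ys))"
      by (intro rec_fun_subst[where F = "\<lambda>\<beta> c. bounded_eval (l c) (e c) f", OF PrimRec.IH(1)])
        (auto intro!: rec_fun_proj)
    \<comment> \<open>Inside the recursion \<open>zs\<close> starts with the counter and the encoded
      previous value, which a predecessor decodes. The parameter is then at position 2, the
      recursion argument at 3, and the remaining arguments start at 4.\<close>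
    have g: "rec_fun b (Suc (Suc (Suc k))) (\<lambda>\<beta> zs.
        bounded_eval (l (drop 2 zs ! 0)) (e (drop 2 zs ! 0)) g
          (map (\<lambda>G. G \<beta> zs) [\<lambda>\<beta> zs. zs ! 0, \<lambda>\<beta> zs. zs ! 1 - 1] @ drop 4 zs))"
      by (intro rec_fun_subst[where F = "\<lambda>\<beta> c. bounded_eval (l c) (e c) g", OF PrimRec.IH(2)])
        (auto intro!: rec_fun_drop_proj rec_fun_proj rec_fun_pred[unfolded One_nat_def])
    have "rec_fun b (Suc (Suc (Suc k))) (\<lambda>\<beta> zs. if zs ! 1 = 0 then 0 else
        bounded_eval (l (drop 2 zs ! 0)) (e (drop 2 zs ! 0)) g (zs ! 0 # (zs ! 1 - 1) # drop 2 (drop 2 zs)))"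
      using g by (intro rec_fun_if rec_fun_const rec_fun_proj) simp_all
    then have "rec_fun b (Suc k) (\<lambda>\<beta> ys. rec_nat (bounded_eval (l (ys ! 0)) (e (ys ! 0)) f (drop 2 ys))
        (\<lambda>m r. if r = 0 then 0
           else bounded_eval (l (ys ! 0)) (e (ys ! 0)) g (m # (r - 1) # drop 2 ys)) (ys ! 1))"
      using f Suc by (intro rec_fun_primrec rec_fun_proj) simp_all
    then show ?thesis
    proof (rule rec_fun_cong)
      fix ys :: "nat list" assume "length ys = Suc k"
      then obtain c n zs where "ys = c # n # zs" using Suc by (auto simp: length_Suc_conv)
      then show "rec_nat (bounded_eval (l (ys ! 0)) (e (ys ! 0)) f (drop 2 ys))
        (\<lambda>m r. if r = 0 then 0
           else bounded_eval (l (ys ! 0)) (e (ys ! 0)) g (m # (r - 1) # drop 2 ys)) (ys ! 1)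
        = bounded_eval (l (ys ! 0)) (e (ys ! 0)) (PrimRec f g) (drop 1 ys)"
        by (simp cong: if_cong)
    qed
  qed
next
  case (Minim f)
  \<comment> \<open>Here \<open>zs\<close> consists of the counter, the current state of the search,
    the parameter and the arguments; the body sees the counter followed by the arguments.\<close>
  have f: "rec_fun b (Suc (Suc (Suc k))) (\<lambda>\<beta> zs.
      bounded_eval (l (drop 2 zs ! 0)) (e (drop 2 zs ! 0)) f
        (map (\<lambda>G. G \<beta> zs) [\<lambda>\<beta> zs. zs ! 0] @ drop 3 zs))"
    by (intro rec_fun_subst[where F = "\<lambda>\<beta> c. bounded_eval (l c) (e c) f", OF Minim.IH])
      (auto intro!: rec_fun_drop_proj rec_fun_proj)
  have f: "rec_fun b (Suc (Suc (Suc k))) (\<lambda>\<beta> zs.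
      bounded_eval (l (drop 2 zs ! 0)) (e (drop 2 zs ! 0)) f (zs ! 0 # drop 1 (drop 2 zs)))"
    using f by (simp add: numeral_3_eq_3)
  have "rec_fun b (Suc k) (\<lambda>\<beta> ys.
      search (\<lambda>n. bounded_eval (l (ys ! 0)) (e (ys ! 0)) f (n # drop 1 ys)) (l (ys ! 0)))"
    unfolding search_conv_rec_nat
    by (intro rec_fun_primrec rec_fun_if rec_fun_Suc rec_fun_pred rec_fun_const f
        rec_fun_computable[OF l] rec_fun_proj) auto
  then show ?case by (auto dest: rec_fun_pred)
qed

section \<open>Programs and associates\<close>

definition reduces :: "prog \<Rightarrow> (nat \<Rightarrow> nat) \<Rightarrow> (nat \<Rightarrow> nat) \<Rightarrow> bool" where
  "reduces p \<beta> \<gamma> \<longleftrightarrow> (\<forall>n. eval \<beta> p [n] (\<gamma> n))"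

lemma reduces_functional: "reduces p \<beta> \<gamma> \<Longrightarrow> reduces p \<beta> \<gamma>' \<Longrightarrow> \<gamma> = \<gamma>'"
  unfolding reduces_def by (metis eval_functional ext)

lemma K2_val_functional:
  assumes "K2_val code \<alpha> \<beta> k" "K2_val code \<alpha> \<beta> k'"
  shows "k = k'"
proof -
  from assms obtain n n' where
    n: "\<alpha> (code (prefix \<beta> n)) = k + 1" "\<forall>m<n. \<alpha> (code (prefix \<beta> m)) = 0" and
    n': "\<alpha> (code (prefix \<beta> n')) = k' + 1" "\<forall>m<n'. \<alpha> (code (prefix \<beta> m)) = 0"
    unfolding K2_val_def by blast
  then have "n = n'" by (metis add_eq_0_iff_both_eq_0 linorder_neqE_nat one_neq_zero)
  with n n' show ?thesis by simp
qed

lemma K2_app_eq_Some_iff: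
  "K2_app code \<alpha> \<beta> = Some \<gamma> \<longleftrightarrow> (\<forall>n. K2_val code \<alpha> (case_nat n \<beta>) (\<gamma> n))"
proof
  assume "K2_app code \<alpha> \<beta> = Some \<gamma>"
  then have *: "\<forall>n. \<exists>k. K2_val code \<alpha> (case_nat n \<beta>) k"
    "\<gamma> = (\<lambda>n. THE k. K2_val code \<alpha> (case_nat n \<beta>) k)"
    by (auto simp: K2_app_def split: if_splits)
  show "\<forall>n. K2_val code \<alpha> (case_nat n \<beta>) (\<gamma> n)"
    unfolding *(2) using *(1) by (metis (mono_tags, lifting) K2_val_functional the_equality)
next
  assume *: "\<forall>n. K2_val code \<alpha> (case_nat n \<beta>) (\<gamma> n)"
  then have "(THE k. K2_val code \<alpha> (case_nat n \<beta>) k) = \<gamma> n" for n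
    by (blast intro: the_equality K2_val_functional)
  with * show "K2_app code \<alpha> \<beta> = Some \<gamma>" by (auto simp: K2_app_def)
qed

text \<open>Along the prefixes of \<open>(n) * \<beta>\<close>, soundness and determinism make every
  nonzero value of the associate equal to \<open>\<gamma> n + 1\<close>, so stopping at the first
  one is correct; completeness ensures that one occurs.\<close>

lemma program_associate:
  assumes "computable_coding code"
  shows "\<exists>\<alpha>. computable \<alpha> \<and> (\<forall>\<beta> \<gamma>. reduces p \<beta> \<gamma> \<longrightarrow> K2_app code \<alpha> \<beta> = Some \<gamma>)"
proof -
  from assms obtain len entry where
    len: "computable len" "\<And>s. len (code s) = length s" and
    entry: "computable2 entry" "\<And>s i. i < length s \<Longrightarrow> entry (code s) i = s ! i"
    by (auto simp: computable_coding_def)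
  \<comment> \<open>A code of \<open>(n) * \<sigma>\<close> stands for the input \<open>n\<close> together with the finite oracle \<open>\<sigma>\<close>.\<close>
  define l where "l c = len c - 1" for c
  define e where "e c x = entry c (Suc x)" for c x
  define \<alpha> where "\<alpha> c = (if len c = 0 then 0 else bounded_eval (l c) (e c) p [entry c 0])" for c
  have rl: "rec_fun True 1 (\<lambda>\<beta> ys. len (ys ! 0) - 1)"
    by (intro rec_fun_pred rec_fun_computable[OF len(1)] rec_fun_proj) simp
  have l: "computable l"
    using rl unfolding rec_fun_def computable_def l_def
    by (metis One_nat_def length_Cons list.size(3) nth_Cons_0)
  have re: "rec_fun True 2 (\<lambda>\<beta> ys. entry (ys ! 0) (Suc (ys ! 1)))"
    by (intro rec_fun_computable2[OF entry(1)] rec_fun_Suc rec_fun_proj) auto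
  then obtain q where "oracle_free q"
    and q: "\<And>\<beta> ys. length ys = 2 \<Longrightarrow> eval \<beta> q ys (entry (ys ! 0) (Suc (ys ! 1)))"
    unfolding rec_fun_def by auto
  moreover have "eval \<beta> q [c, x] (e c x)" for \<beta> c x
    using q[of "[c, x]" \<beta>] by (simp add: e_def)
  ultimately have e: "computable2 e"
    unfolding computable2_def by blast
  have "rec_fun True 1 (\<lambda>\<beta> ys. bounded_eval (l (ys ! 0)) (e (ys ! 0)) p
      (map (\<lambda>G. G \<beta> ys) [\<lambda>\<beta> ys. entry (ys ! 0) 0] @ drop 1 ys))"
    by (intro rec_fun_subst[where F = "\<lambda>\<beta> c. bounded_eval (l c) (e c) p", OF rec_fun_bounded_eval[OF l e]])
      (auto intro!: rec_fun_proj rec_fun_computable2[OF entry(1)] rec_fun_const)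
  then have "rec_fun True 1 (\<lambda>\<beta> ys. if len (ys ! 0) = 0 then 0 else bounded_eval (l (ys ! 0)) (e (ys ! 0)) p
      (map (\<lambda>G. G \<beta> ys) [\<lambda>\<beta> ys. entry (ys ! 0) 0] @ drop 1 ys))"
    by (intro rec_fun_if rec_fun_const rec_fun_computable[OF len(1)] rec_fun_proj) auto
  then have "rec_fun True 1 (\<lambda>\<beta> ys. \<alpha> (ys ! 0))"
    by (rule rec_fun_cong) (simp add: \<alpha>_def)
  then have "computable \<alpha>"
    unfolding rec_fun_def computable_def
    by (metis One_nat_def length_Cons list.size(3) nth_Cons_0)
  moreover have "K2_app code \<alpha> \<beta> = Some \<gamma>" if red: "reduces p \<beta> \<gamma>" for \<beta> \<gamma>
    unfolding K2_app_eq_Some_iff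
  proof
    fix n
    let ?a = "\<lambda>m. \<alpha> (code (prefix (case_nat n \<beta>) m))"
    \<comment> \<open>The empty prefix does not yet contain the input, so the answer is
      postponed.\<close>
    have a0: "?a 0 = 0" by (simp add: \<alpha>_def len prefix_def)
    \<comment> \<open>A prefix of length \<open>m + 1\<close> holds \<open>n\<close> and the first
      \<open>m\<close> oracle values, whence the bound \<open>m\<close>.\<close>
    have a_Suc: "?a (Suc m) = bounded_eval m \<beta> p [n]" for m
    proof -
      let ?c = "code (prefix (case_nat n \<beta>) (Suc m))"
      have "length (prefix (case_nat n \<beta>) (Suc m)) = Suc m" by (simp add: prefix_def)
      moreover have entry: "entry ?c i = case_nat n \<beta> i" if "i < Suc m" for i
        using that by (subst entry(2)) (auto simp: prefix_def simp del: upt_Suc)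
      moreover have "bounded_eval m (e ?c) p [n] = bounded_eval m \<beta> p [n]"
        by (rule bounded_eval_cong) (simp add: e_def entry)
      ultimately show ?thesis by (simp add: \<alpha>_def l_def len)
    qed
    have val: "eval \<beta> p [n] (\<gamma> n)" using red by (simp add: reduces_def)
    have a: "?a m = 0 \<or> ?a m = \<gamma> n + 1" for m
    proof (cases m)
      case (Suc j)
      show ?thesis
      proof (cases "?a m")
        case (Suc k)
        then have "eval \<beta> p [n] k" using \<open>m = Suc j\<close> a_Suc bounded_eval_sound by simp
        then show ?thesis using Suc val eval_functional by fastforce
      qed simp
    qed (use a0 in simp)
    obtain L where "bounded_eval L \<beta> p [n] = Suc (\<gamma> n)"
      using bounded_eval_complete[OF val] by (auto simp: eventually_sequentially)
    then have "?a (Suc L) \<noteq> 0" by (simp add: a_Suc)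
    then obtain m where "?a m \<noteq> 0" "\<forall>j<m. ?a j = 0"
      using exists_least_iff[of "\<lambda>m. ?a m \<noteq> 0"] by auto
    with a[of m] show "K2_val code \<alpha> (case_nat n \<beta>) (\<gamma> n)"
      unfolding K2_val_def by blast
  qed
  ultimately show ?thesis by blast
qed

lemma associate_program:
  assumes "computable_coding code" "computable \<alpha>"
  shows "\<exists>p. \<forall>\<beta> \<gamma>. K2_app code \<alpha> \<beta> = Some \<gamma> \<longrightarrow> reduces p \<beta> \<gamma>"
proof -
  from assms(1) obtain snoc where
    snoc: "computable2 snoc" "\<And>s x. snoc (code s) x = code (s @ [x])"
    by (auto simp: computable_coding_def)
  let ?a = "\<lambda>\<beta> m n. \<alpha> (code (prefix (case_nat n \<beta>) m))"
  \<comment> \<open>The code of a prefix is built by recursion on its length: \<open>zs ! 0\<close>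
    is the length so far, \<open>zs ! 1\<close> the code so far and \<open>drop 2 zs ! 1\<close> the
    input. The entry to append is the input at position 0 and an oracle value, shifted by one,
    afterwards.\<close>
  have "rec_fun False (Suc (Suc 2)) (\<lambda>\<beta> zs. snoc (zs ! 1)
      (if zs ! 0 = 0 then drop 2 zs ! 1 else \<beta> (zs ! 0 - 1)))"
    by (intro rec_fun_computable2[OF snoc(1)] rec_fun_if rec_fun_oracle rec_fun_pred
        rec_fun_proj rec_fun_drop_proj) auto
  then have "rec_fun False 2 (\<lambda>\<beta> xs. rec_nat (code [])
      (\<lambda>m r. snoc r (if m = 0 then xs ! 1 else \<beta> (m - 1))) (xs ! 0))"
    by (intro rec_fun_primrec rec_fun_const rec_fun_proj) auto
  moreover have "rec_nat (code []) (\<lambda>m r. snoc r (if m = 0 then n else \<beta> (m - 1))) m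
      = code (prefix (case_nat n \<beta>) m)" for n \<beta> m
    by (induction m) (auto simp: prefix_def snoc(2) split: nat.split)
  ultimately have a: "rec_fun False 2 (\<lambda>\<beta> xs. ?a \<beta> (xs ! 0) (xs ! 1))"
    by (intro rec_fun_computable[OF assms(2)]) simp
  \<comment> \<open>\<open>Minim\<close> stops at the value 0, while an associate answers with a
    nonzero value, so \<open>q\<close> exchanges the two cases.\<close>
  from rec_fun_if[OF a rec_fun_const[of _ _ 1] rec_fun_const[of _ _ 0]]
  obtain q where q: "\<And>\<beta> xs. length xs = 2 \<Longrightarrow>
      eval \<beta> q xs (if ?a \<beta> (xs ! 0) (xs ! 1) = 0 then 1 else 0)"
    unfolding rec_fun_def by auto
  from rec_fun_pred[OF a] obtain r where r: "\<And>\<beta> xs. length xs = 2 \<Longrightarrow>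
      eval \<beta> r xs (?a \<beta> (xs ! 0) (xs ! 1) - 1)"
    unfolding rec_fun_def by auto
  \<comment> \<open>\<open>Minim q\<close> finds the length of the first answering prefix;
    \<open>r\<close> reads the answer there and removes the offset of one.\<close>
  let ?p = "Comp r [Minim q, Proj 0]"
  have "reduces ?p \<beta> \<gamma>" if app: "K2_app code \<alpha> \<beta> = Some \<gamma>" for \<beta> \<gamma>
    unfolding reduces_def
  proof
    fix n
    from app obtain m where m: "?a \<beta> m n = \<gamma> n + 1" "\<forall>j<m. ?a \<beta> j n = 0"
      unfolding K2_app_eq_Some_iff K2_val_def by blast
    have "eval \<beta> q [m, n] 0" using q[of "[m, n]" \<beta>] m(1) by simp
    moreover have "eval \<beta> q [j, n] (Suc 0)" if "j < m" for j
      using q[of "[j, n]" \<beta>] m(2) that by simp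
    ultimately have "eval \<beta> (Minim q) [n] m" by (blast intro: eval.Minim)
    moreover have "eval \<beta> (Proj 0) [n] n" using eval.Proj[of 0 "[n]"] by simp
    moreover have "eval \<beta> r [m, n] (\<gamma> n)" using r[of "[m, n]" \<beta>] m(1) by simp
    ultimately show "eval \<beta> ?p [n] (\<gamma> n)"
      by (intro eval.Comp[where ys = "[m, n]"]) auto
  qed
  then show ?thesis by blast
qed

section \<open>Composition of reductions\<close>

primrec subst_oracle :: "prog \<Rightarrow> prog \<Rightarrow> prog" where
  "subst_oracle q Zero = Zero"
| "subst_oracle q Succ = Succ"
| "subst_oracle q (Proj i) = Proj i"
| "subst_oracle q Oracle = q"
| "subst_oracle q (Comp f gs) = Comp (subst_oracle q f) (map (subst_oracle q) gs)"
| "subst_oracle q (PrimRec f g) = PrimRec (subst_oracle q f) (subst_oracle q g)"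
| "subst_oracle q (Minim f) = Minim (subst_oracle q f)"

text \<open>Each query to \<open>\<gamma>\<close> is answered by running \<open>q\<close> with
  oracle \<open>\<beta>\<close>. This is the source of transitivity for all three
  reducibilities.\<close>

lemma eval_subst_oracle:
  assumes "reduces q \<beta> \<gamma>"
  shows "eval \<gamma> p xs y \<Longrightarrow> eval \<beta> (subst_oracle q p) xs y"
proof (induction rule: eval.induct)
  case (Oracle x)
  then show ?case using assms by (simp add: reduces_def)
next
  case (Comp xs gs ys f z)
  from Comp.IH(1) have "list_all2 (\<lambda>g y. eval \<beta> g xs y) (map (subst_oracle q) gs) ys"
    by (auto simp: list_all2_conv_all_nth)
  with Comp.IH(2) show ?case by (auto intro: eval.intros)
next
  case (PrimRec_Suc f g n xs y z)
  then show ?case using eval.PrimRec_Suc by simp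
next
  case (Minim f n xs)
  then show ?case using eval.Minim by simp blast
qed (auto intro: eval.intros)

lemma reduces_Oracle: "reduces Oracle \<beta> \<beta>"
  by (simp add: reduces_def eval.Oracle)

lemma reduces_subst_oracle:
  "reduces q \<beta> \<gamma> \<Longrightarrow> reduces p \<gamma> \<delta> \<Longrightarrow> reduces (subst_oracle q p) \<beta> \<delta>"
  by (simp add: reduces_def[of _ _ \<delta>] eval_subst_oracle)

lemma computable_functional_iff:
  "computable_functional \<Phi> \<longleftrightarrow> (\<exists>p. \<forall>\<beta> \<gamma>. \<Phi> \<beta> = Some \<gamma> \<longleftrightarrow> reduces p \<beta> \<gamma>)"
  by (simp add: computable_functional_def reduces_def)

text \<open>Since programs are deterministic, \<open>reduces p\<close> is the graph of a partial
  function. This lets programs replace functionals in Medvedev and Muchnik reducibility.\<close>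

lemma program_functional:
  "\<exists>\<Phi>. computable_functional \<Phi> \<and> (\<forall>\<beta> \<gamma>. \<Phi> \<beta> = Some \<gamma> \<longleftrightarrow> reduces p \<beta> \<gamma>)"
proof -
  let ?\<Phi> = "\<lambda>\<beta>. if \<exists>\<gamma>. reduces p \<beta> \<gamma> then Some (THE \<gamma>. reduces p \<beta> \<gamma>) else None"
  have "(THE \<gamma>. reduces p \<beta> \<gamma>) = \<gamma>" if "reduces p \<beta> \<gamma>" for \<beta> \<gamma>
    using that by (blast intro: the_equality reduces_functional)
  then have "\<forall>\<beta> \<gamma>. ?\<Phi> \<beta> = Some \<gamma> \<longleftrightarrow> reduces p \<beta> \<gamma>"
    by (metis option.distinct(1) option.inject)
  then show ?thesis
    unfolding computable_functional_iff by (intro exI[of _ ?\<Phi>] conjI exI[of _ p])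
qed

section \<open>Comparison of the preorders\<close>

lemma turing_reducible_iff: "turing_reducible \<alpha> \<beta> \<longleftrightarrow> (\<exists>p. reduces p \<beta> \<alpha>)"
  by (simp add: turing_reducible_def reduces_def)

lemma medvedev_reducible_iff:
  "medvedev_reducible P Q \<longleftrightarrow> (\<exists>p. \<forall>\<beta>\<in>Q. \<exists>\<gamma>\<in>P. reduces p \<beta> \<gamma>)"
proof
  assume "medvedev_reducible P Q"
  then obtain \<Phi> where \<Phi>: "computable_functional \<Phi>" "\<forall>q\<in>Q. \<exists>p\<in>P. \<Phi> q = Some p"
    unfolding medvedev_reducible_def by blast
  from \<Phi>(1) obtain p where "\<forall>\<beta> \<gamma>. \<Phi> \<beta> = Some \<gamma> \<longleftrightarrow> reduces p \<beta> \<gamma>"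
    unfolding computable_functional_iff by blast
  with \<Phi>(2) show "\<exists>p. \<forall>\<beta>\<in>Q. \<exists>\<gamma>\<in>P. reduces p \<beta> \<gamma>" by auto
next
  assume "\<exists>p. \<forall>\<beta>\<in>Q. \<exists>\<gamma>\<in>P. reduces p \<beta> \<gamma>"
  then obtain p where p: "\<forall>\<beta>\<in>Q. \<exists>\<gamma>\<in>P. reduces p \<beta> \<gamma>" ..
  obtain \<Phi> where \<Phi>: "computable_functional \<Phi>" "\<forall>\<beta> \<gamma>. \<Phi> \<beta> = Some \<gamma> \<longleftrightarrow> reduces p \<beta> \<gamma>"
    using program_functional by blast
  from p have "\<forall>q\<in>Q. \<exists>\<gamma>\<in>P. \<Phi> q = Some \<gamma>" unfolding \<Phi>(2)[rule_format] .
  with \<Phi>(1) show "medvedev_reducible P Q" unfolding medvedev_reducible_def by blast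
qed

text \<open>Treating the points of \<open>Q\<close> one at a time leaves Medvedev reducibility to
  singletons, where functionals and programs have already been matched.\<close>

lemma muchnik_reducible_iff:
  "muchnik_reducible P Q \<longleftrightarrow> (\<forall>\<beta>\<in>Q. \<exists>p. \<exists>\<gamma>\<in>P. reduces p \<beta> \<gamma>)"
proof -
  have "muchnik_reducible P Q \<longleftrightarrow> (\<forall>\<beta>\<in>Q. medvedev_reducible P {\<beta>})"
    by (simp add: muchnik_reducible_def medvedev_reducible_def)
  then show ?thesis by (simp add: medvedev_reducible_iff)
qed

section \<open>The reducibilities as preorders\<close>

lemma preorder_turing_reducible: "reflp turing_reducible" "transp turing_reducible"
proof -
  show "reflp turing_reducible"
    unfolding turing_reducible_iff by (auto intro!: reflpI intro: reduces_Oracle)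
  show "transp turing_reducible"
  proof (rule transpI)
    fix \<alpha> \<beta> \<gamma> assume "turing_reducible \<alpha> \<beta>" "turing_reducible \<beta> \<gamma>"
    then obtain p q where "reduces p \<beta> \<alpha>" "reduces q \<gamma> \<beta>"
      unfolding turing_reducible_iff by blast
    from reduces_subst_oracle[OF this(2,1)] show "turing_reducible \<alpha> \<gamma>"
      unfolding turing_reducible_iff ..
  qed
qed

lemma preorder_medvedev_reducible: "reflp medvedev_reducible" "transp medvedev_reducible"
proof -
  show "reflp medvedev_reducible"
    unfolding medvedev_reducible_iff by (auto intro!: reflpI intro: reduces_Oracle)
  show "transp medvedev_reducible"
  proof (rule transpI)
    fix P Q R assume "medvedev_reducible P Q" "medvedev_reducible Q R"
    then obtain p q where
      p: "\<forall>\<beta>\<in>Q. \<exists>\<gamma>\<in>P. reduces p \<beta> \<gamma>" and q: "\<forall>\<beta>\<in>R. \<exists>\<gamma>\<in>Q. reduces q \<beta> \<gamma>"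
      unfolding medvedev_reducible_iff by blast
    have "\<exists>\<delta>\<in>P. reduces (subst_oracle q p) \<beta> \<delta>" if "\<beta> \<in> R" for \<beta>
    proof -
      from q that obtain \<gamma> where \<gamma>: "\<gamma> \<in> Q" "reduces q \<beta> \<gamma>" by blast
      with p obtain \<delta> where \<delta>: "\<delta> \<in> P" "reduces p \<gamma> \<delta>" by blast
      show ?thesis by (rule bexI[of _ \<delta>]) (rule reduces_subst_oracle[OF \<gamma>(2) \<delta>(2)], rule \<delta>(1))
    qed
    then show "medvedev_reducible P R" unfolding medvedev_reducible_iff by blast
  qed
qed

lemma preorder_muchnik_reducible: "reflp muchnik_reducible" "transp muchnik_reducible"
proof -
  show "reflp muchnik_reducible"
    unfolding muchnik_reducible_iff by (auto intro!: reflpI intro: reduces_Oracle)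
  show "transp muchnik_reducible"
  proof (rule transpI)
    fix P Q R assume PQ: "muchnik_reducible P Q" and QR: "muchnik_reducible Q R"
    show "muchnik_reducible P R"
      unfolding muchnik_reducible_iff
    proof
      fix \<beta> assume "\<beta> \<in> R"
      with QR obtain q \<gamma> where q: "\<gamma> \<in> Q" "reduces q \<beta> \<gamma>"
        unfolding muchnik_reducible_iff by blast
      with PQ obtain p \<delta> where p: "\<delta> \<in> P" "reduces p \<gamma> \<delta>"
        unfolding muchnik_reducible_iff by blast
      with reduces_subst_oracle[OF q(2)] show "\<exists>p. \<exists>\<gamma>\<in>P. reduces p \<beta> \<gamma>"
        by (intro exI[of _ "subst_oracle q p"] bexI[of _ \<delta>])
    qed
  qed
qed

section \<open>The doctrines at a one-element set\<close>

lemma turing_le_iff: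
  assumes "computable_coding code"
  shows "turing_le (K2_app code) K2_rec (\<lambda>_::unit. \<alpha>) (\<lambda>_. \<beta>) \<longleftrightarrow> turing_reducible \<alpha> \<beta>"
proof
  assume "turing_le (K2_app code) K2_rec (\<lambda>_::unit. \<alpha>) (\<lambda>_. \<beta>)"
  then obtain a where "computable a" "K2_app code a \<beta> = Some \<alpha>"
    by (auto simp: turing_le_def K2_rec_def)
  with assms show "turing_reducible \<alpha> \<beta>"
    unfolding turing_reducible_iff using associate_program by blast
next
  assume "turing_reducible \<alpha> \<beta>"
  then obtain p where "reduces p \<beta> \<alpha>" unfolding turing_reducible_iff ..
  moreover obtain a where "computable a" "\<forall>\<beta> \<gamma>. reduces p \<beta> \<gamma> \<longrightarrow> K2_app code a \<beta> = Some \<gamma>"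
    using program_associate[OF assms] by blast
  ultimately show "turing_le (K2_app code) K2_rec (\<lambda>_::unit. \<alpha>) (\<lambda>_. \<beta>)"
    unfolding turing_le_def K2_rec_def by blast
qed

text \<open>Both translations between programs and associates choose their witness before the
  oracle, so one witness serves all of \<open>Q\<close>.\<close>

lemma medvedev_le_iff:
  assumes "computable_coding code"
  shows "medvedev_le (K2_app code) K2_rec (\<lambda>_::unit. P) (\<lambda>_. Q) \<longleftrightarrow> medvedev_reducible P Q"
proof
  assume "medvedev_le (K2_app code) K2_rec (\<lambda>_::unit. P) (\<lambda>_. Q)"
  then obtain a where a: "computable a" "\<forall>\<beta>\<in>Q. \<exists>\<gamma>\<in>P. K2_app code a \<beta> = Some \<gamma>"
    by (auto simp: medvedev_le_def K2_rec_def)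
  obtain p where "\<forall>\<beta> \<gamma>. K2_app code a \<beta> = Some \<gamma> \<longrightarrow> reduces p \<beta> \<gamma>"
    using associate_program[OF assms a(1)] by blast
  with a(2) show "medvedev_reducible P Q" unfolding medvedev_reducible_iff by blast
next
  assume "medvedev_reducible P Q"
  then obtain p where p: "\<forall>\<beta>\<in>Q. \<exists>\<gamma>\<in>P. reduces p \<beta> \<gamma>" unfolding medvedev_reducible_iff ..
  obtain a where "computable a" "\<forall>\<beta> \<gamma>. reduces p \<beta> \<gamma> \<longrightarrow> K2_app code a \<beta> = Some \<gamma>"
    using program_associate[OF assms] by blast
  with p show "medvedev_le (K2_app code) K2_rec (\<lambda>_::unit. P) (\<lambda>_. Q)"
    unfolding medvedev_le_def K2_rec_def by blast
qed

lemma muchnik_le_iff: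
  assumes "computable_coding code"
  shows "muchnik_le (K2_app code) K2_rec (\<lambda>_::unit. P) (\<lambda>_. Q) \<longleftrightarrow> muchnik_reducible P Q"
proof -
  \<comment> \<open>For fixed \<open>\<beta>\<close> the quantifiers over the associate and over the
    result commute, leaving a Turing comparison with some element of \<open>P\<close>.\<close>
  have "muchnik_le (K2_app code) K2_rec (\<lambda>_::unit. P) (\<lambda>_. Q) \<longleftrightarrow>
      (\<forall>\<beta>\<in>Q. \<exists>\<gamma>\<in>P. turing_le (K2_app code) K2_rec (\<lambda>_::unit. \<gamma>) (\<lambda>_. \<beta>))"
    unfolding muchnik_le_def turing_le_def by blast
  also have "\<dots> \<longleftrightarrow> muchnik_reducible P Q"
    unfolding turing_le_iff[OF assms] turing_reducible_iff muchnik_reducible_iff by blast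
  finally show ?thesis .
qed

section \<open>Poset reflections and their isomorphisms\<close>

lemma partial_order_on_poset_reflection:
  assumes refl: "reflp le" and trans: "transp le"
  shows "partial_order_on (fst (poset_reflection le)) (snd (poset_reflection le))"
proof -
  define R where "R = {(x, y). le x y \<and> le y x}"
  define D where "D = UNIV // R"
  let ?S = "{(C, C'). C \<in> D \<and> C' \<in> D \<and> (\<exists>x\<in>C. \<exists>y\<in>C'. le x y)}"
  have equiv: "equiv UNIV R"
    unfolding R_def using assms
    by (auto intro!: equivI refl_onI symI transI dest: reflpD transpD)
  \<comment> \<open>Members of one class are comparable in both directions, so representatives can
    be changed in the chains below.\<close>
  have le: "le x y" if "C \<in> D" "x \<in> C" "y \<in> C" for C x y
    using quotient_eq_iff[OF equiv, of C C x y] that by (auto simp: R_def D_def)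
  have "refl_on D ?S"
  proof (rule refl_onI)
    fix C assume C: "C \<in> D"
    then obtain x where "x \<in> C"
      using equiv in_quotient_imp_non_empty unfolding D_def by blast
    with C show "(C, C) \<in> ?S" using reflpD[OF refl] by blast
  qed
  moreover have "trans ?S"
  proof (rule transI, clarify)
    fix C1 C2 C3 x y y' z
    assume C: "C2 \<in> D" and xy: "x \<in> C1" "y \<in> C2" "le x y" "y' \<in> C2" "z \<in> C3" "le y' z"
    have "le x z" using transpD[OF trans] xy le[OF C xy(2,4)] by blast
    with xy show "\<exists>x\<in>C1. \<exists>z\<in>C3. le x z" by blast
  qed
  moreover have "antisym ?S"
  proof (rule antisymI, clarify)
    fix C C' x y x' y'
    assume C: "C \<in> D" "C' \<in> D"
      and xy: "x \<in> C" "y \<in> C'" "le x y" "x' \<in> C'" "y' \<in> C" "le x' y'"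
    have "le y x" using transpD[OF trans] le[OF C(2) xy(2,4)] xy(6) le[OF C(1) xy(5,1)] by blast
    with xy(3) show "C = C'"
      using quotient_eq_iff[OF equiv C[unfolded D_def] xy(1,2)] by (simp add: R_def)
  qed
  moreover have "?S \<subseteq> D \<times> D" by blast
  moreover have "poset_reflection le = (D, ?S)"
    by (simp add: poset_reflection_def R_def D_def Let_def)
  ultimately show ?thesis by (simp add: partial_order_on_def preorder_on_def)
qed

text \<open>As \<open>g\<close> preserves and reflects the preorder, taking images under
  \<open>g\<close> maps equivalence classes onto equivalence classes and is the required
  isomorphism.\<close>

lemma poset_isomorphic_poset_reflection:
  assumes g: "bij g" and le: "\<And>x y. le' (g x) (g y) \<longleftrightarrow> le x y"
    and pre: "reflp le" "transp le"
  shows "poset_isomorphic (poset_reflection le) (poset_reflection le')"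
proof -
  define R where "R = {(x, y). le x y \<and> le y x}"
  define R' where "R' = {(x, y). le' x y \<and> le' y x}"
  have eq: "poset_reflection le =
      (UNIV // R, {(C, C'). C \<in> UNIV // R \<and> C' \<in> UNIV // R \<and> (\<exists>x\<in>C. \<exists>y\<in>C'. le x y)})"
    "poset_reflection le' =
      (UNIV // R', {(C, C'). C \<in> UNIV // R' \<and> C' \<in> UNIV // R' \<and> (\<exists>x\<in>C. \<exists>y\<in>C'. le' x y)})"
    by (simp_all add: poset_reflection_def R_def R'_def Let_def)
  \<comment> \<open>Expressing \<open>le'\<close> through the inverse of \<open>g\<close> transfers
    reflexivity and transitivity to it.\<close>
  have le': "le' u v \<longleftrightarrow> le (inv g u) (inv g v)" for u v
    using g le[of "inv g u" "inv g v"] by (simp add: bij_is_surj surj_f_inv_f)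
  have pre': "reflp le'" "transp le'"
    using pre by (auto intro!: reflpI transpI simp: le' dest: reflpD transpD)
  have img: "g ` (R `` {x}) = R' `` {g x}" for x
  proof (intro equalityI subsetI)
    fix u assume "u \<in> R' `` {g x}"
    moreover obtain v where "u = g v" using g by (metis bij_pointE)
    ultimately show "u \<in> g ` (R `` {x})" by (auto simp: R_def R'_def le)
  qed (auto simp: R_def R'_def le)
  have "(`) g ` (UNIV // R) = (\<lambda>x. R' `` {g x}) ` UNIV"
    by (auto simp: quotient_def img image_iff)
  also have "\<dots> = (\<lambda>u. R' `` {u}) ` range g" by (simp add: image_image)
  also have "\<dots> = UNIV // R'" using g by (auto simp: quotient_def bij_is_surj)
  finally have D: "(`) g ` (UNIV // R) = UNIV // R'" .
  have "inj ((`) g)" using g by (auto intro!: injI simp: inj_image_eq_iff bij_is_inj)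
  then have bij: "bij_betw ((`) g) (UNIV // R) (UNIV // R')"
    unfolding bij_betw_def using D by (auto intro: inj_on_subset)
  have mem: "g ` C \<in> UNIV // R'" if "C \<in> UNIV // R" for C
    unfolding D[symmetric] using that by (rule imageI)
  show ?thesis
    unfolding poset_isomorphic_def
  proof (intro conjI exI[of _ "(`) g"] ballI)
    show "bij_betw ((`) g) (fst (poset_reflection le)) (fst (poset_reflection le'))"
      unfolding eq fst_conv by (rule bij)
    fix C C' assume "C \<in> fst (poset_reflection le)" "C' \<in> fst (poset_reflection le)"
    then show "(C, C') \<in> snd (poset_reflection le) \<longleftrightarrow> (g ` C, g ` C') \<in> snd (poset_reflection le')"
      unfolding eq fst_conv snd_conv by (simp add: mem le)
  qed (intro partial_order_on_poset_reflection pre pre')+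
qed

text \<open>A function on a one-element set amounts to its value. The value type is left open:
  sequences for the Turing doctrine, sets of sequences for the other two.\<close>

lemma bij_const_unit: "bij (\<lambda>x (_::unit). x)"
  by (rule bijI) (auto simp: inj_def fun_eq_iff surj_def)

theorem theorem4p15:
  fixes code :: "nat list \<Rightarrow> nat"
  assumes "computable_coding code"
  shows "poset_isomorphic turing_degrees (turing_doctrine (K2_app code) K2_rec TYPE(unit)) \<and>
         poset_isomorphic medvedev_degrees (medvedev_doctrine (K2_app code) K2_rec TYPE(unit)) \<and>
         poset_isomorphic muchnik_degrees (muchnik_doctrine (K2_app code) K2_rec TYPE(unit))"
  unfolding turing_degrees_def medvedev_degrees_def muchnik_degrees_def
    turing_doctrine_def medvedev_doctrine_def muchnik_doctrine_def
  using assms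
  by (intro conjI poset_isomorphic_poset_reflection[OF bij_const_unit]
      preorder_turing_reducible preorder_medvedev_reducible preorder_muchnik_reducible
      turing_le_iff medvedev_le_iff muchnik_le_iff)

end
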